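(* Let $n\ge2$, let $A$ be an associative unital algebra over a commutative ring $k$, and let $\rho\in A\otimes A$ be an invertible solution to the algebraic Yang-Baxter equation. Let $VP_n$ be the pure virtual braid group with generators $\mu_{ij}$ ($1\le i\ne j\le n$) and relations $\mu_{ij}\mu_{ik}\mu_{jk}=\mu_{jk}\mu_{ik}\mu_{ij}$ for all distinct $i,j,k$ and $\mu_{ij}\mu_{kl}=\mu_{kl}\mu_{ij}$ whenever $\{i,j\}\cap\{k,l\}=\emptyset$. Then the assignment $$rep(\mu_{ij})=\rho_{ij}$$ extends to a representation $rep:VP_n\to A^{\otimes n}$, i.e. to a group homomorphism from $VP_n$ to the group of invertible elements of the algebra $A^{\otimes n}$.
   Context: Tensor products are over $k$. Write $\rho=\sum e\otimes e'$ (a finite sum, summation index suppressed). For $i<j$, $\rho_{ij}\in A^{\otimes n}$ is $\sum 1\otimes\cdots\otimes e\otimes\cdots\otimes e'\otimes\cdots\otimes1$ with $e$ in the $i$-th and $e'$ in the $j$-th tensor factor and $1_A$ elsewhere; for $i<j$, $\rho_{ji}$ is the same sum with $e'$ in the $i$-th and $e$ in the $j$-th factor. (So $\rho_{rs}$ always has $e$ in factor $r$ and $e'$ in factor $s$.) The element $\rho$ is a solution to the algebraic Yang-Baxter equation if $\rho_{12}\rho_{13}\rho_{23}=\rho_{23}\rho_{13}\rho_{12}$ in $A^{\otimes 3}$ (hence in $A^{\otimes m}$ for all $m\ge3$). *)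

theory Defs
  imports "HOL-Algebra.Algebra"
begin

section \<open>Associative unital algebras\<close>

text \<open>The locale \<^locale>\<open>algebra\<close> of the library requires the algebra to be commutative.\<close>

locale assoc_algebra = module R A + A?: ring A for R (structure) and A (structure) +
  assumes smult_mult_left:
      "\<lbrakk>c \<in> carrier R; x \<in> carrier A; y \<in> carrier A\<rbrakk> \<Longrightarrow>
        (c \<odot>\<^bsub>A\<^esub> x) \<otimes>\<^bsub>A\<^esub> y = c \<odot>\<^bsub>A\<^esub> (x \<otimes>\<^bsub>A\<^esub> y)"
    and smult_mult_right:
      "\<lbrakk>c \<in> carrier R; x \<in> carrier A; y \<in> carrier A\<rbrakk> \<Longrightarrow>
        x \<otimes>\<^bsub>A\<^esub> (c \<odot>\<^bsub>A\<^esub> y) = c \<odot>\<^bsub>A\<^esub> (x \<otimes>\<^bsub>A\<^esub> y)"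

section \<open>Tensor powers\<close>

definition support :: "('k, 'r) ring_scheme \<Rightarrow> ('x \<Rightarrow> 'k) \<Rightarrow> 'x set" where
  "support R f = {x. f x \<noteq> \<zero>\<^bsub>R\<^esub>}"

definition delta :: "('k, 'r) ring_scheme \<Rightarrow> 'x \<Rightarrow> 'x \<Rightarrow> 'k" where
  "delta R x = (\<lambda>z. if z = x then \<one>\<^bsub>R\<^esub> else \<zero>\<^bsub>R\<^esub>)"

text \<open>As an \<open>R\<close>-module, \<open>monoid_algebra R G\<close> is the free module on the set \<^term>\<open>carrier G\<close>;
  the product is the bilinear extension of the multiplication of \<open>G\<close>.\<close>

definition monoid_algebra ::
    "('k, 'r) ring_scheme \<Rightarrow> ('x, 'g) monoid_scheme \<Rightarrow> ('k, 'x \<Rightarrow> 'k) module" where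
  "monoid_algebra R G =
    \<lparr>carrier = {f. range f \<subseteq> carrier R \<and> finite (support R f) \<and> support R f \<subseteq> carrier G},
     monoid.mult = (\<lambda>f g z. \<Oplus>\<^bsub>R\<^esub>p\<in>{p \<in> support R f \<times> support R g. fst p \<otimes>\<^bsub>G\<^esub> snd p = z}.
               f (fst p) \<otimes>\<^bsub>R\<^esub> g (snd p)),
     one = delta R \<one>\<^bsub>G\<^esub>,
     ring.zero = (\<lambda>z. \<zero>\<^bsub>R\<^esub>),
     ring.add = (\<lambda>f g z. f z \<oplus>\<^bsub>R\<^esub> g z),
     module.smult = (\<lambda>c f z. c \<otimes>\<^bsub>R\<^esub> f z)\<rparr>"

definition submodule_span ::
    "('k, 'r) ring_scheme \<Rightarrow> ('k, 'v, 'm) module_scheme \<Rightarrow> 'v set \<Rightarrow> 'v set" where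
  "submodule_span R M S = \<Inter>{H. submodule H R M \<and> S \<subseteq> H}"

text \<open>The Cartesian power of \<open>A\<close>, a multiplicative monoid under the componentwise product.
  Tensor factors are numbered from \<open>1\<close> to \<open>n\<close>.\<close>

definition cartesian_power :: "('k, 'a, 'm) module_scheme \<Rightarrow> nat \<Rightarrow> (nat \<Rightarrow> 'a) monoid" where
  "cartesian_power A n = product_group {1..n} (\<lambda>_. A)"

definition free_tensors ::
    "('k, 'r) ring_scheme \<Rightarrow> ('k, 'a, 'm) module_scheme \<Rightarrow> nat \<Rightarrow> ('k, (nat \<Rightarrow> 'a) \<Rightarrow> 'k) module" where
  "free_tensors R A n = monoid_algebra R (cartesian_power A n)"

definition multilinear_rels ::
    "('k, 'r) ring_scheme \<Rightarrow> ('k, 'a, 'm) module_scheme \<Rightarrow> nat \<Rightarrow> ((nat \<Rightarrow> 'a) \<Rightarrow> 'k) set" where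
  "multilinear_rels R A n =
    {delta R (x(i := a \<oplus>\<^bsub>A\<^esub> b)) \<ominus>\<^bsub>free_tensors R A n\<^esub>
       (delta R (x(i := a)) \<oplus>\<^bsub>free_tensors R A n\<^esub> delta R (x(i := b))) | x i a b.
       x \<in> carrier (cartesian_power A n) \<and> i \<in> {1..n} \<and> a \<in> carrier A \<and> b \<in> carrier A}
    \<union> {delta R (x(i := c \<odot>\<^bsub>A\<^esub> a)) \<ominus>\<^bsub>free_tensors R A n\<^esub>
       (c \<odot>\<^bsub>free_tensors R A n\<^esub> delta R (x(i := a))) | x i c a.
       x \<in> carrier (cartesian_power A n) \<and> i \<in> {1..n} \<and> c \<in> carrier R \<and> a \<in> carrier A}"

definition multilinear_span ::
    "('k, 'r) ring_scheme \<Rightarrow> ('k, 'a, 'm) module_scheme \<Rightarrow> nat \<Rightarrow> ((nat \<Rightarrow> 'a) \<Rightarrow> 'k) set" where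
  "multilinear_span R A n = submodule_span R (free_tensors R A n) (multilinear_rels R A n)"

text \<open>The \<open>n\<close>-fold tensor power of \<open>A\<close> over \<open>R\<close>: the free module on \<open>n\<close>-tuples modulo the
  submodule of multilinearity relations, with the product induced from the componentwise
  product of tuples.\<close>

definition tensor_power ::
    "('k, 'r) ring_scheme \<Rightarrow> ('k, 'a, 'm) module_scheme \<Rightarrow> nat \<Rightarrow> ((nat \<Rightarrow> 'a) \<Rightarrow> 'k) set ring" where
  "tensor_power R A n = free_tensors R A n Quot multilinear_span R A n"

text \<open>\<open>pure_tensor R A n x\<close> is \<open>x 1 \<otimes> \<dots> \<otimes> x n\<close>.\<close>

definition pure_tensor ::
    "('k, 'r) ring_scheme \<Rightarrow> ('k, 'a, 'm) module_scheme \<Rightarrow> nat \<Rightarrow> (nat \<Rightarrow> 'a) \<Rightarrow>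
      ((nat \<Rightarrow> 'a) \<Rightarrow> 'k) set" where
  "pure_tensor R A n x =
    multilinear_span R A n +>\<^bsub>free_tensors R A n\<^esub> delta R (restrict x {1..n})"

section \<open>The algebraic Yang-Baxter equation\<close>

text \<open>The element \<open>\<Sum>s<m. e s \<otimes> e' s\<close> of the tensor square.\<close>

definition tensor2 ::
    "('k, 'r) ring_scheme \<Rightarrow> ('k, 'a, 'm) module_scheme \<Rightarrow> nat \<Rightarrow> (nat \<Rightarrow> 'a) \<Rightarrow> (nat \<Rightarrow> 'a) \<Rightarrow>
      ((nat \<Rightarrow> 'a) \<Rightarrow> 'k) set" where
  "tensor2 R A m e e' =
    (\<Oplus>\<^bsub>tensor_power R A 2\<^esub>s\<in>{..<m}. pure_tensor R A 2 (\<lambda>l. if l = 1 then e s else e' s))"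

text \<open>The same sum in the \<open>n\<close>-th tensor power, with \<open>e s\<close> in factor \<open>i\<close>, \<open>e' s\<close> in factor \<open>j\<close>
  and \<open>\<one>\<close> elsewhere; \<open>i < j\<close> is not required, only \<open>i \<noteq> j\<close>.\<close>

definition leg ::
    "('k, 'r) ring_scheme \<Rightarrow> ('k, 'a, 'm) module_scheme \<Rightarrow> nat \<Rightarrow> (nat \<Rightarrow> 'a) \<Rightarrow> (nat \<Rightarrow> 'a) \<Rightarrow>
      nat \<Rightarrow> nat \<Rightarrow> nat \<Rightarrow> ((nat \<Rightarrow> 'a) \<Rightarrow> 'k) set" where
  "leg R A m e e' n i j =
    (\<Oplus>\<^bsub>tensor_power R A n\<^esub>s\<in>{..<m}.
       pure_tensor R A n (\<lambda>l. if l = i then e s else if l = j then e' s else \<one>\<^bsub>A\<^esub>))"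

definition yang_baxter ::
    "('k, 'r) ring_scheme \<Rightarrow> ('k, 'a, 'm) module_scheme \<Rightarrow> nat \<Rightarrow> (nat \<Rightarrow> 'a) \<Rightarrow> (nat \<Rightarrow> 'a) \<Rightarrow>
      bool" where
  "yang_baxter R A m e e' \<longleftrightarrow>
    leg R A m e e' 3 1 2 \<otimes>\<^bsub>tensor_power R A 3\<^esub> leg R A m e e' 3 1 3
      \<otimes>\<^bsub>tensor_power R A 3\<^esub> leg R A m e e' 3 2 3
    = leg R A m e e' 3 2 3 \<otimes>\<^bsub>tensor_power R A 3\<^esub> leg R A m e e' 3 1 3
      \<otimes>\<^bsub>tensor_power R A 3\<^esub> leg R A m e e' 3 1 2"

section \<open>Groups given by generators and relations\<close>

text \<open>A letter \<open>(g, True)\<close> stands for the generator \<open>g\<close> and \<open>(g, False)\<close> for its inverse;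
  a relation \<open>u = v\<close> is encoded as the pair of words \<open>(u, v)\<close>.\<close>

type_synonym 'g word = "('g \<times> bool) list"

inductive word_equiv :: "'g set \<Rightarrow> ('g word \<times> 'g word) set \<Rightarrow> 'g word \<Rightarrow> 'g word \<Rightarrow> bool"
  for S :: "'g set" and rels :: "('g word \<times> 'g word) set" where
  refl: "w \<in> lists (S \<times> UNIV) \<Longrightarrow> word_equiv S rels w w"
| sym: "word_equiv S rels u v \<Longrightarrow> word_equiv S rels v u"
| trans: "word_equiv S rels u v \<Longrightarrow> word_equiv S rels v w \<Longrightarrow> word_equiv S rels u w"
| cancel: "\<lbrakk>u \<in> lists (S \<times> UNIV); v \<in> lists (S \<times> UNIV); g \<in> S\<rbrakk> \<Longrightarrow>
    word_equiv S rels (u @ [(g, b), (g, \<not> b)] @ v) (u @ v)"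
| rel: "\<lbrakk>u \<in> lists (S \<times> UNIV); v \<in> lists (S \<times> UNIV);
      l \<in> lists (S \<times> UNIV); r \<in> lists (S \<times> UNIV); (l, r) \<in> rels\<rbrakk> \<Longrightarrow>
    word_equiv S rels (u @ l @ v) (u @ r @ v)"

definition word_class :: "'g set \<Rightarrow> ('g word \<times> 'g word) set \<Rightarrow> 'g word \<Rightarrow> 'g word set" where
  "word_class S rels w = {w'. word_equiv S rels w w'}"

definition presented_group :: "'g set \<Rightarrow> ('g word \<times> 'g word) set \<Rightarrow> 'g word set monoid" where
  "presented_group S rels =
    \<lparr>carrier = word_class S rels ` lists (S \<times> UNIV),
     monoid.mult = (\<lambda>U V. \<Union>u\<in>U. \<Union>v\<in>V. word_class S rels (u @ v)),
     one = word_class S rels []\<rparr>"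

section \<open>The pure virtual braid group\<close>

definition VP_gens :: "nat \<Rightarrow> (nat \<times> nat) set" where
  "VP_gens n = {(i, j). i \<in> {1..n} \<and> j \<in> {1..n} \<and> i \<noteq> j}"

definition VP_rels :: "nat \<Rightarrow> ((nat \<times> nat) word \<times> (nat \<times> nat) word) set" where
  "VP_rels n =
    {([((i, j), True), ((i, k), True), ((j, k), True)],
      [((j, k), True), ((i, k), True), ((i, j), True)]) | i j k.
        {i, j, k} \<subseteq> {1..n} \<and> distinct [i, j, k]}
    \<union> {([((i, j), True), ((k, l), True)], [((k, l), True), ((i, j), True)]) | i j k l.
        (i, j) \<in> VP_gens n \<and> (k, l) \<in> VP_gens n \<and> {i, j} \<inter> {k, l} = {}}"

definition VP :: "nat \<Rightarrow> (nat \<times> nat) word set monoid" where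
  "VP n = presented_group (VP_gens n) (VP_rels n)"

definition mu :: "nat \<Rightarrow> nat \<Rightarrow> nat \<Rightarrow> (nat \<times> nat) word set" where
  "mu n i j = word_class (VP_gens n) (VP_rels n) [((i, j), True)]"

end

theory Submission
  imports Defs
begin

text \<open>An injection of \<open>{1..p}\<close> into \<open>{1..n}\<close> places \<open>p\<close> tensor factors among \<open>n\<close> and puts \<open>\<one>\<close>
  elsewhere, which is a ring homomorphism from the \<open>p\<close>-th to the \<open>n\<close>-th tensor power. For \<open>p = 2\<close> it
  carries the invertible element \<open>\<rho>\<close> to \<open>\<rho>\<^sub>i\<^sub>j\<close>, so \<open>\<rho>\<^sub>i\<^sub>j\<close> is invertible; for \<open>p = 3\<close> it
  carries the Yang-Baxter equation to the first family of relations. The second family holds because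
  pure tensors with disjoint supports commute.\<close>

section \<open>Monoid algebras\<close>

text \<open>The tensor power is a quotient of the monoid algebra on \<open>n\<close>-tuples. The
  relations are divided out as a submodule, so the product of cosets is meaningful only once their
  span is known to be a two-sided ideal. This holds because a multilinearity relation, multiplied by
  a tuple, is a multilinearity relation in the same slot. Placing factors is compatible with the
  relations for a similar reason: on tuples it is an injective monoid homomorphism, and its linear
  extension moves a relation in slot \<open>i\<close> to one in slot \<open>\<tau> i\<close>.
  Homomorphisms replace formulas for the sake of invertibility: the inverse of \<rho> comes without
  a chosen decomposition into pure tensors, but its image still inverts
  \<open>\<rho>\<^sub>i\<^sub>j\<close>. Since \<tau> is merely injective and may reverse the order,
  pairs with \<open>i < j\<close> and \<open>i > j\<close> are treated alike, and one equation in
  the third tensor power yields the relations for every ordering of three distinct indices.\<close>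

lemma carrier_monoid_algebra:
    "carrier (monoid_algebra R G) =
      {f. range f \<subseteq> carrier R \<and> finite (support R f) \<and> support R f \<subseteq> carrier G}"
  and one_monoid_algebra [simp]: "\<one>\<^bsub>monoid_algebra R G\<^esub> = delta R \<one>\<^bsub>G\<^esub>"
  and zero_monoid_algebra [simp]: "\<zero>\<^bsub>monoid_algebra R G\<^esub> = (\<lambda>z. \<zero>\<^bsub>R\<^esub>)"
  and add_monoid_algebra: "f \<oplus>\<^bsub>monoid_algebra R G\<^esub> g = (\<lambda>z. f z \<oplus>\<^bsub>R\<^esub> g z)"
  and smult_monoid_algebra: "c \<odot>\<^bsub>monoid_algebra R G\<^esub> f = (\<lambda>z. c \<otimes>\<^bsub>R\<^esub> f z)"
  and mult_monoid_algebra: "f \<otimes>\<^bsub>monoid_algebra R G\<^esub> g =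
    (\<lambda>z. \<Oplus>\<^bsub>R\<^esub>p\<in>{p \<in> support R f \<times> support R g. fst p \<otimes>\<^bsub>G\<^esub> snd p = z}.
      f (fst p) \<otimes>\<^bsub>R\<^esub> g (snd p))"
  by (simp_all add: monoid_algebra_def)

locale cring_monoid = cring R + G: monoid G for R (structure) and G (structure)
begin

abbreviation F where "F \<equiv> monoid_algebra R G"

lemma value_closed: "f \<in> carrier F \<Longrightarrow> f z \<in> carrier R"
  by (auto simp: carrier_monoid_algebra)

lemma monoid_algebra_memI:
  assumes "\<And>z. f z \<in> carrier R" and "finite S" and "S \<subseteq> carrier G" and "support R f \<subseteq> S"
  shows "f \<in> carrier F"
  using assms by (auto simp: carrier_monoid_algebra intro: finite_subset)

lemma support_finite: "f \<in> carrier F \<Longrightarrow> finite (support R f)"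
  and support_subset: "f \<in> carrier F \<Longrightarrow> support R f \<subseteq> carrier G"
  by (auto simp: carrier_monoid_algebra)

lemma zero_closed_F: "(\<lambda>z. \<zero>) \<in> carrier F"
  by (rule monoid_algebra_memI[where S = "{}"]) (auto simp: support_def)

lemma delta_closed: "x \<in> carrier G \<Longrightarrow> delta R x \<in> carrier F"
  by (rule monoid_algebra_memI[where S = "{x}"]) (auto simp: support_def delta_def)

lemma add_closed_F: "\<lbrakk>f \<in> carrier F; g \<in> carrier F\<rbrakk> \<Longrightarrow> f \<oplus>\<^bsub>F\<^esub> g \<in> carrier F"
  by (rule monoid_algebra_memI[where S = "support R f \<union> support R g"])
    (auto simp: support_finite support_subset[THEN subsetD] value_closed add_monoid_algebra,
     auto simp: support_def value_closed)

lemma smult_closed_F: "\<lbrakk>c \<in> carrier R; f \<in> carrier F\<rbrakk> \<Longrightarrow> c \<odot>\<^bsub>F\<^esub> f \<in> carrier F"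
  by (rule monoid_algebra_memI[where S = "support R f"])
    (auto simp: support_finite support_subset[THEN subsetD] value_closed smult_monoid_algebra,
     auto simp: support_def value_closed)

text \<open>The support is stripped one point at a time, \<open>f\<close> being
  \<open>f(x := \<zero>)\<close> plus \<open>f x\<close> times \<open>delta R x\<close>. This rule
  reduces linear and bilinear identities to basis elements.\<close>

lemma monoid_algebra_induct [consumes 1, case_names zero delta add smult]:
  assumes f: "f \<in> carrier F"
    and zero: "P (\<lambda>z. \<zero>)"
    and delta: "\<And>x. x \<in> carrier G \<Longrightarrow> P (delta R x)"
    and add: "\<And>f g. \<lbrakk>f \<in> carrier F; g \<in> carrier F; P f; P g\<rbrakk> \<Longrightarrow> P (f \<oplus>\<^bsub>F\<^esub> g)"
    and smult: "\<And>c f. \<lbrakk>c \<in> carrier R; f \<in> carrier F; P f\<rbrakk> \<Longrightarrow> P (c \<odot>\<^bsub>F\<^esub> f)"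
  shows "P f"
proof -
  have "P f" if "finite S" "f \<in> carrier F" "support R f \<subseteq> S" "S \<subseteq> carrier G" for S f
    using that
  proof (induction S arbitrary: f rule: finite_induct)
    case empty
    then have "f = (\<lambda>z. \<zero>)" by (auto simp: support_def)
    with zero show ?case by simp
  next
    case (insert x S)
    let ?g = "f(x := \<zero>)"
    have x: "x \<in> carrier G" and fx: "f x \<in> carrier R"
      using insert by (auto intro: value_closed)
    have g: "?g \<in> carrier F"
      using insert by (intro monoid_algebra_memI[where S = S])
        (auto simp: value_closed support_def)
    moreover have "support R ?g \<subseteq> S" using insert by (auto simp: support_def)
    ultimately have "P ?g" using insert by auto
    moreover have "f = ?g \<oplus>\<^bsub>F\<^esub> (f x \<odot>\<^bsub>F\<^esub> delta R x)"
      using insert.prems by (auto simp: add_monoid_algebra smult_monoid_algebra delta_def value_closed)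
    ultimately show ?case
      using add[OF g smult_closed_F[OF fx delta_closed[OF x]]] smult[OF fx delta_closed[OF x]] delta[OF x]
      by metis
  qed
  with f show ?thesis by (metis support_finite support_subset subset_refl)
qed

text \<open>The defining sum runs over a fibre inside the supports, which changes with
  \<open>f\<close> and \<open>g\<close>. A fixed rectangle as index set lets sums for different
  factors be combined termwise.\<close>

lemma mult_supersets:
  assumes "f \<in> carrier F" "g \<in> carrier F"
    and "finite S" "finite T" "support R f \<subseteq> S" "support R g \<subseteq> T"
  shows "(f \<otimes>\<^bsub>F\<^esub> g) z =
    (\<Oplus>p\<in>S \<times> T. if fst p \<otimes>\<^bsub>G\<^esub> snd p = z then f (fst p) \<otimes> g (snd p) else \<zero>)"
  unfolding mult_monoid_algebra
proof (rule add.finprod_mono_neutral_cong_left)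
  show "finite (S \<times> T)" using assms by simp
  show "{p \<in> support R f \<times> support R g. fst p \<otimes>\<^bsub>G\<^esub> snd p = z} \<subseteq> S \<times> T"
    using assms by auto
  show "(if fst p \<otimes>\<^bsub>G\<^esub> snd p = z then f (fst p) \<otimes> g (snd p) else \<zero>) = \<zero>"
    if "p \<in> S \<times> T - {p \<in> support R f \<times> support R g. fst p \<otimes>\<^bsub>G\<^esub> snd p = z}" for p
    using that assms(1,2) by (auto simp: support_def value_closed)
qed (use assms(1,2) in \<open>auto simp: value_closed\<close>)

lemma mult_closed_F:
  assumes "f \<in> carrier F" "g \<in> carrier F"
  shows "f \<otimes>\<^bsub>F\<^esub> g \<in> carrier F"
proof (rule monoid_algebra_memI)
  let ?S = "(\<lambda>p. fst p \<otimes>\<^bsub>G\<^esub> snd p) ` (support R f \<times> support R g)"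
  show "(f \<otimes>\<^bsub>F\<^esub> g) z \<in> carrier R" for z
    using assms by (auto simp: mult_monoid_algebra value_closed intro!: finsum_closed)
  show "finite ?S" using assms by (simp add: support_finite)
  show "?S \<subseteq> carrier G" using support_subset[OF assms(1)] support_subset[OF assms(2)] by (auto intro!: G.m_closed)
  show "support R (f \<otimes>\<^bsub>F\<^esub> g) \<subseteq> ?S"
  proof
    fix z assume "z \<in> support R (f \<otimes>\<^bsub>F\<^esub> g)"
    \<comment> \<open>An empty fibre would make the sum empty and the value zero.\<close>
    then have "{p \<in> support R f \<times> support R g. fst p \<otimes>\<^bsub>G\<^esub> snd p = z} \<noteq> {}"
      by (auto simp: support_def mult_monoid_algebra simp del: Collect_empty_eq)
    then show "z \<in> ?S" by (force intro: image_eqI)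
  qed
qed

lemma l_distr_F:
  assumes "f \<in> carrier F" "g \<in> carrier F" "h \<in> carrier F"
  shows "(f \<oplus>\<^bsub>F\<^esub> g) \<otimes>\<^bsub>F\<^esub> h = f \<otimes>\<^bsub>F\<^esub> h \<oplus>\<^bsub>F\<^esub> g \<otimes>\<^bsub>F\<^esub> h"
proof
  fix z
  \<comment> \<open>Cancellation can make the support of the sum smaller than this union; one
    rectangle for all three products permits termwise addition.\<close>
  let ?S = "support R f \<union> support R g" and ?T = "support R h"
  let ?c = "\<lambda>f g p. if fst p \<otimes>\<^bsub>G\<^esub> snd p = z then f (fst p) \<otimes> g (snd p) else \<zero>"
  have "support R (f \<oplus>\<^bsub>F\<^esub> g) \<subseteq> support R f \<union> support R g"
    using assms by (auto simp: support_def add_monoid_algebra)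
  then have "((f \<oplus>\<^bsub>F\<^esub> g) \<otimes>\<^bsub>F\<^esub> h) z = (\<Oplus>p\<in>?S \<times> ?T. ?c (f \<oplus>\<^bsub>F\<^esub> g) h p)"
    using assms by (intro mult_supersets) (auto simp: support_finite add_closed_F)
  also have "\<dots> = (\<Oplus>p\<in>?S \<times> ?T. ?c f h p \<oplus> ?c g h p)"
    using assms by (intro finsum_cong') (auto simp: value_closed add_monoid_algebra l_distr)
  also have "\<dots> = (\<Oplus>p\<in>?S \<times> ?T. ?c f h p) \<oplus> (\<Oplus>p\<in>?S \<times> ?T. ?c g h p)"
    using assms by (intro finsum_addf) (auto simp: value_closed)
  also have "(\<Oplus>p\<in>?S \<times> ?T. ?c f h p) = (f \<otimes>\<^bsub>F\<^esub> h) z"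
    using assms by (intro mult_supersets[symmetric]) (auto simp: support_finite)
  also have "(\<Oplus>p\<in>?S \<times> ?T. ?c g h p) = (g \<otimes>\<^bsub>F\<^esub> h) z"
    using assms by (intro mult_supersets[symmetric]) (auto simp: support_finite)
  finally show "((f \<oplus>\<^bsub>F\<^esub> g) \<otimes>\<^bsub>F\<^esub> h) z = (f \<otimes>\<^bsub>F\<^esub> h \<oplus>\<^bsub>F\<^esub> g \<otimes>\<^bsub>F\<^esub> h) z"
    by (simp add: add_monoid_algebra[where f = "f \<otimes>\<^bsub>F\<^esub> h"])
qed

lemma r_distr_F:
  assumes "f \<in> carrier F" "g \<in> carrier F" "h \<in> carrier F"
  shows "h \<otimes>\<^bsub>F\<^esub> (f \<oplus>\<^bsub>F\<^esub> g) = h \<otimes>\<^bsub>F\<^esub> f \<oplus>\<^bsub>F\<^esub> h \<otimes>\<^bsub>F\<^esub> g"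
proof
  fix z
  let ?S = "support R h" and ?T = "support R f \<union> support R g"
  let ?c = "\<lambda>f g p. if fst p \<otimes>\<^bsub>G\<^esub> snd p = z then f (fst p) \<otimes> g (snd p) else \<zero>"
  have "support R (f \<oplus>\<^bsub>F\<^esub> g) \<subseteq> support R f \<union> support R g"
    using assms by (auto simp: support_def add_monoid_algebra)
  then have "(h \<otimes>\<^bsub>F\<^esub> (f \<oplus>\<^bsub>F\<^esub> g)) z = (\<Oplus>p\<in>?S \<times> ?T. ?c h (f \<oplus>\<^bsub>F\<^esub> g) p)"
    using assms by (intro mult_supersets) (auto simp: support_finite add_closed_F)
  also have "\<dots> = (\<Oplus>p\<in>?S \<times> ?T. ?c h f p \<oplus> ?c h g p)"
    using assms by (intro finsum_cong') (auto simp: value_closed add_monoid_algebra r_distr)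
  also have "\<dots> = (\<Oplus>p\<in>?S \<times> ?T. ?c h f p) \<oplus> (\<Oplus>p\<in>?S \<times> ?T. ?c h g p)"
    using assms by (intro finsum_addf) (auto simp: value_closed)
  also have "(\<Oplus>p\<in>?S \<times> ?T. ?c h f p) = (h \<otimes>\<^bsub>F\<^esub> f) z"
    using assms by (intro mult_supersets[symmetric]) (auto simp: support_finite)
  also have "(\<Oplus>p\<in>?S \<times> ?T. ?c h g p) = (h \<otimes>\<^bsub>F\<^esub> g) z"
    using assms by (intro mult_supersets[symmetric]) (auto simp: support_finite)
  finally show "(h \<otimes>\<^bsub>F\<^esub> (f \<oplus>\<^bsub>F\<^esub> g)) z = (h \<otimes>\<^bsub>F\<^esub> f \<oplus>\<^bsub>F\<^esub> h \<otimes>\<^bsub>F\<^esub> g) z"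
    by (simp add: add_monoid_algebra[where f = "h \<otimes>\<^bsub>F\<^esub> f"])
qed

lemma smult_mult_left_F:
  assumes "c \<in> carrier R" "f \<in> carrier F" "g \<in> carrier F"
  shows "(c \<odot>\<^bsub>F\<^esub> f) \<otimes>\<^bsub>F\<^esub> g = c \<odot>\<^bsub>F\<^esub> (f \<otimes>\<^bsub>F\<^esub> g)"
proof
  fix z
  \<comment> \<open>Zero divisors of \<open>R\<close> can shrink the support of the multiple of
    \<open>f\<close>, so both sides are summed over the supports of \<open>f\<close> and
    \<open>g\<close>.\<close>
  let ?S = "support R f" and ?T = "support R g"
  let ?c = "\<lambda>f g p. if fst p \<otimes>\<^bsub>G\<^esub> snd p = z then f (fst p) \<otimes> g (snd p) else \<zero>"
  have "((c \<odot>\<^bsub>F\<^esub> f) \<otimes>\<^bsub>F\<^esub> g) z = (\<Oplus>p\<in>?S \<times> ?T. ?c (c \<odot>\<^bsub>F\<^esub> f) g p)"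
    using assms by (intro mult_supersets)
      (auto simp: support_finite smult_closed_F, auto simp: support_def smult_monoid_algebra)
  also have "\<dots> = (\<Oplus>p\<in>?S \<times> ?T. c \<otimes> ?c f g p)"
    using assms by (intro finsum_cong') (auto simp: value_closed smult_monoid_algebra m_assoc)
  also have "\<dots> = c \<otimes> (\<Oplus>p\<in>?S \<times> ?T. ?c f g p)"
    using assms by (intro finsum_rdistr[symmetric]) (auto simp: value_closed support_finite)
  also have "(\<Oplus>p\<in>?S \<times> ?T. ?c f g p) = (f \<otimes>\<^bsub>F\<^esub> g) z"
    using assms by (intro mult_supersets[symmetric]) (auto simp: support_finite)
  finally show "((c \<odot>\<^bsub>F\<^esub> f) \<otimes>\<^bsub>F\<^esub> g) z = (c \<odot>\<^bsub>F\<^esub> (f \<otimes>\<^bsub>F\<^esub> g)) z"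
    by (simp add: smult_monoid_algebra[where f = "f \<otimes>\<^bsub>F\<^esub> g"])
qed

lemma smult_mult_right_F:
  assumes "c \<in> carrier R" "f \<in> carrier F" "g \<in> carrier F"
  shows "f \<otimes>\<^bsub>F\<^esub> (c \<odot>\<^bsub>F\<^esub> g) = c \<odot>\<^bsub>F\<^esub> (f \<otimes>\<^bsub>F\<^esub> g)"
proof
  fix z
  let ?S = "support R f" and ?T = "support R g"
  let ?c = "\<lambda>f g p. if fst p \<otimes>\<^bsub>G\<^esub> snd p = z then f (fst p) \<otimes> g (snd p) else \<zero>"
  have "(f \<otimes>\<^bsub>F\<^esub> (c \<odot>\<^bsub>F\<^esub> g)) z = (\<Oplus>p\<in>?S \<times> ?T. ?c f (c \<odot>\<^bsub>F\<^esub> g) p)"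
    using assms by (intro mult_supersets)
      (auto simp: support_finite smult_closed_F, auto simp: support_def smult_monoid_algebra)
  \<comment> \<open>Commutativity of \<open>R\<close> moves \<open>c\<close> past the value of
    \<open>f\<close>.\<close>
  also have "\<dots> = (\<Oplus>p\<in>?S \<times> ?T. c \<otimes> ?c f g p)"
    using assms by (intro finsum_cong') (auto simp: value_closed smult_monoid_algebra m_lcomm)
  also have "\<dots> = c \<otimes> (\<Oplus>p\<in>?S \<times> ?T. ?c f g p)"
    using assms by (intro finsum_rdistr[symmetric]) (auto simp: value_closed support_finite)
  also have "(\<Oplus>p\<in>?S \<times> ?T. ?c f g p) = (f \<otimes>\<^bsub>F\<^esub> g) z"
    using assms by (intro mult_supersets[symmetric]) (auto simp: support_finite)
  finally show "(f \<otimes>\<^bsub>F\<^esub> (c \<odot>\<^bsub>F\<^esub> g)) z = (c \<odot>\<^bsub>F\<^esub> (f \<otimes>\<^bsub>F\<^esub> g)) z"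
    by (simp add: smult_monoid_algebra[where f = "f \<otimes>\<^bsub>F\<^esub> g"])
qed

lemma delta_mult:
  assumes "x \<in> carrier G" "y \<in> carrier G"
  shows "delta R x \<otimes>\<^bsub>F\<^esub> delta R y = delta R (x \<otimes>\<^bsub>G\<^esub> y)"
proof
  fix z
  have "support R (delta R x) \<subseteq> {x}" "support R (delta R y) \<subseteq> {y}"
    by (auto simp: support_def delta_def)
  then show "(delta R x \<otimes>\<^bsub>F\<^esub> delta R y) z = delta R (x \<otimes>\<^bsub>G\<^esub> y) z"
    using assms
    by (simp add: mult_supersets[where S = "{x}" and T = "{y}"] delta_closed)
      (auto simp: delta_def)
qed

lemma abelian_group_F: "abelian_group F"
proof (rule abelian_groupI)
  fix f assume f: "f \<in> carrier F"
  have "(\<lambda>z. \<ominus> f z) \<in> carrier F"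
    using f by (intro monoid_algebra_memI[where S = "support R f"])
      (auto simp: value_closed support_finite support_subset[THEN subsetD], auto simp: support_def)
  moreover have "(\<lambda>z. \<ominus> f z) \<oplus>\<^bsub>F\<^esub> f = \<zero>\<^bsub>F\<^esub>"
    using f by (auto simp: add_monoid_algebra value_closed l_neg)
  ultimately show "\<exists>g\<in>carrier F. g \<oplus>\<^bsub>F\<^esub> f = \<zero>\<^bsub>F\<^esub>" by blast
qed (auto simp: zero_closed_F add_closed_F, auto simp: add_monoid_algebra value_closed a_ac)

lemma module_F: "module R F"
  by (rule moduleI)
    (auto simp: abelian_group_F smult_closed_F is_cring,
     auto simp: smult_monoid_algebra add_monoid_algebra value_closed l_distr r_distr m_assoc)

sublocale F: module R F
  by (rule module_F)

lemma mult_zero_F: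
  "(\<lambda>z. \<zero>) \<otimes>\<^bsub>F\<^esub> f = (\<lambda>z. \<zero>)" "f \<otimes>\<^bsub>F\<^esub> (\<lambda>z. \<zero>) = (\<lambda>z. \<zero>)"
  by (auto simp: mult_monoid_algebra support_def)

text \<open>Both sides are linear in each argument, so three nested inductions leave only basis
  elements, where the claim is associativity in \<open>G\<close>. No triple sum has to be
  reindexed.\<close>

lemma mult_assoc_F:
  assumes "f \<in> carrier F" "g \<in> carrier F" "h \<in> carrier F"
  shows "f \<otimes>\<^bsub>F\<^esub> g \<otimes>\<^bsub>F\<^esub> h = f \<otimes>\<^bsub>F\<^esub> (g \<otimes>\<^bsub>F\<^esub> h)"
  using assms(1)
proof (induction rule: monoid_algebra_induct)
  case (delta x)
  show ?case
    using assms(2)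
  proof (induction rule: monoid_algebra_induct)
    case (delta y)
    show ?case
      using assms(3)
      by (induction rule: monoid_algebra_induct)
        (simp_all add: \<open>x \<in> carrier G\<close> delta delta_mult delta_closed G.m_assoc mult_closed_F
          mult_zero_F r_distr_F smult_mult_right_F)
  qed (simp_all add: \<open>x \<in> carrier G\<close> assms mult_closed_F delta_closed mult_zero_F l_distr_F r_distr_F
        smult_mult_left_F smult_mult_right_F)
qed (simp_all add: assms mult_closed_F mult_zero_F l_distr_F smult_mult_left_F)

lemma assoc_algebra_F: "assoc_algebra R F"
proof (intro assoc_algebra.intro assoc_algebra_axioms.intro module_F ringI abelian_group_F)
  show "Group.monoid F"
  proof (rule monoidI)
    fix f assume "f \<in> carrier F"
    then show "\<one>\<^bsub>F\<^esub> \<otimes>\<^bsub>F\<^esub> f = f" "f \<otimes>\<^bsub>F\<^esub> \<one>\<^bsub>F\<^esub> = f"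
      by (induction rule: monoid_algebra_induct)
        (simp_all add: mult_zero_F delta_mult delta_closed l_distr_F r_distr_F
          smult_mult_left_F smult_mult_right_F)
  qed (simp_all add: mult_closed_F mult_assoc_F delta_closed)
qed (simp_all add: l_distr_F r_distr_F smult_mult_left_F smult_mult_right_F)

end

section \<open>Spans and two-sided ideals\<close>

lemma (in module) submodule_span_submodule:
  assumes "S \<subseteq> carrier M"
  shows "submodule (submodule_span R M S) R M"
proof -
  let ?\<S> = "{H. submodule H R M \<and> S \<subseteq> H}"
  \<comment> \<open>The family to be intersected is nonempty, and the intersection stays inside the
    module.\<close>
  have "carrier M \<in> ?\<S>" using assms carrier_is_submodule by simp
  then show ?thesis
    unfolding submodule_span_def
    by (intro submoduleI)
      (use submoduleE(1) in blast,
       auto intro: submoduleE subgroup.one_closed[OF submodule.axioms(1), simplified])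
qed

lemma submodule_span_superset: "S \<subseteq> submodule_span R M S"
  by (auto simp: submodule_span_def)

lemma submodule_span_least: "\<lbrakk>submodule H R M; S \<subseteq> H\<rbrakk> \<Longrightarrow> submodule_span R M S \<subseteq> H"
  by (auto simp: submodule_span_def)

context cring_monoid
begin

sublocale FA: assoc_algebra R F
  by (rule assoc_algebra_F)

text \<open>The span is closed only under linear operations, so absorption of ring elements needs
  proof. Multiplication by an arbitrary element is a linear combination of multiplications by basis
  elements, and these preserve \<open>S\<close>.\<close>

lemma submodule_span_ideal:
  assumes S: "S \<subseteq> carrier F"
    and l: "\<And>x s. \<lbrakk>x \<in> carrier G; s \<in> S\<rbrakk> \<Longrightarrow> delta R x \<otimes>\<^bsub>F\<^esub> s \<in> S"
    and r: "\<And>x s. \<lbrakk>x \<in> carrier G; s \<in> S\<rbrakk> \<Longrightarrow> s \<otimes>\<^bsub>F\<^esub> delta R x \<in> S"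
  shows "ideal (submodule_span R F S) F"
proof -
  let ?I = "submodule_span R F S"
  \<comment> \<open>All left and right multiples of such an \<open>h\<close> lie in the span. These
    elements form a submodule containing \<open>S\<close>, so by minimality they include the whole
    span, which is the absorption property.\<close>
  let ?H = "{h \<in> carrier F. \<forall>f\<in>carrier F. f \<otimes>\<^bsub>F\<^esub> h \<in> ?I \<and> h \<otimes>\<^bsub>F\<^esub> f \<in> ?I}"
  have I: "submodule ?I R F" by (rule F.submodule_span_submodule[OF S])
  note E = F.submoduleE[OF I]
  have zero: "(\<lambda>z. \<zero>) \<in> ?I"
    using subgroup.one_closed[OF submodule.axioms(1)[OF I]] by simp
  have "submodule ?H R F"
    by (rule F.submoduleI)
      (auto simp: mult_zero_F zero_closed_F zero E r_distr_F l_distr_F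
        smult_mult_left_F smult_mult_right_F smult_closed_F FA.r_minus FA.l_minus
        intro: F.M.add.inv_closed)
  moreover have "s \<in> ?H" if "s \<in> S" for s
  proof -
    have s: "s \<in> carrier F" using that S by auto
    have "f \<otimes>\<^bsub>F\<^esub> s \<in> ?I \<and> s \<otimes>\<^bsub>F\<^esub> f \<in> ?I" if "f \<in> carrier F" for f
      using that
    proof (induction rule: monoid_algebra_induct)
      case (delta x)
      then show ?case using l r \<open>s \<in> S\<close> submodule_span_superset[of S R F] by blast
    qed (simp_all add: s zero mult_zero_F l_distr_F r_distr_F smult_mult_left_F smult_mult_right_F E)
    with s show ?thesis by simp
  qed
  ultimately have H: "?I \<subseteq> ?H" by (intro submodule_span_least) auto
  show ?thesis
    by (rule idealI[OF FA.A.ring_axioms submodule.axioms(1)[OF I]]) (use H in auto)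
qed

end

section \<open>Induced homomorphisms of monoid algebras and of quotient rings\<close>

text \<open>The linear extension of \<open>\<phi>\<close> only when \<open>\<phi>\<close> is injective on \<open>C\<close>; no fibres are summed.\<close>

definition pushforward ::
    "('k, 'r) ring_scheme \<Rightarrow> 'x set \<Rightarrow> ('x \<Rightarrow> 'y) \<Rightarrow> ('x \<Rightarrow> 'k) \<Rightarrow> 'y \<Rightarrow> 'k" where
  "pushforward R C \<phi> f = (\<lambda>z. if z \<in> \<phi> ` C then f (inv_into C \<phi> z) else \<zero>\<^bsub>R\<^esub>)"

text \<open>Injectivity makes \<open>inv_into\<close> recover \<open>x\<close> from
  \<open>\<phi> x\<close>, so basis elements go to basis elements. Linearity is checked pointwise,
  and multiplicativity then follows from that of \<open>\<phi>\<close> by induction in both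
  factors.\<close>

lemma pushforward_ring_hom:
  fixes R (structure)
  assumes "cring R" "Group.monoid G" "Group.monoid H"
    and \<phi>: "\<phi> \<in> hom G H" "\<phi> \<one>\<^bsub>G\<^esub> = \<one>\<^bsub>H\<^esub>" "inj_on \<phi> (carrier G)"
  defines "p \<equiv> pushforward R (carrier G) \<phi>"
  shows pushforward_ring_hom_ring: "ring_hom_ring (monoid_algebra R G) (monoid_algebra R H) p"
    and pushforward_delta: "x \<in> carrier G \<Longrightarrow> p (delta R x) = delta R (\<phi> x)"
    and pushforward_smult: "\<lbrakk>c \<in> carrier R; f \<in> carrier (monoid_algebra R G)\<rbrakk> \<Longrightarrow>
      p (c \<odot>\<^bsub>monoid_algebra R G\<^esub> f) = c \<odot>\<^bsub>monoid_algebra R H\<^esub> p f"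
proof -
  interpret G: cring_monoid R G using assms by (simp add: cring_monoid.intro)
  interpret H: cring_monoid R H using assms by (simp add: cring_monoid.intro)
  have \<phi>_closed: "\<phi> x \<in> carrier H" if "x \<in> carrier G" for x
    using that \<phi>(1) by (auto simp: hom_def)
  have delta: "p (delta R x) = delta R (\<phi> x)" if "x \<in> carrier G" for x
    using that \<phi>(3) by (auto simp: p_def pushforward_def delta_def fun_eq_iff)
  have zero: "p (\<lambda>z. \<zero>) = (\<lambda>z. \<zero>)" by (auto simp: p_def pushforward_def)
  have add: "p (f \<oplus>\<^bsub>G.F\<^esub> g) = p f \<oplus>\<^bsub>H.F\<^esub> p g" for f g
    by (auto simp: p_def pushforward_def add_monoid_algebra fun_eq_iff)
  have smult: "p (c \<odot>\<^bsub>G.F\<^esub> f) = c \<odot>\<^bsub>H.F\<^esub> p f" if "c \<in> carrier R" for c f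
    using that by (auto simp: p_def pushforward_def smult_monoid_algebra fun_eq_iff)
  have closed: "p f \<in> carrier H.F" if "f \<in> carrier G.F" for f
    using that
    by (induction rule: G.monoid_algebra_induct)
      (simp_all add: zero delta add smult \<phi>_closed H.zero_closed_F H.delta_closed H.add_closed_F
        H.smult_closed_F)
  have mult: "p (f \<otimes>\<^bsub>G.F\<^esub> g) = p f \<otimes>\<^bsub>H.F\<^esub> p g" if "f \<in> carrier G.F" "g \<in> carrier G.F" for f g
    using that(1)
  proof (induction rule: G.monoid_algebra_induct)
    case (delta x)
    show ?case
      using that(2)
    proof (induction rule: G.monoid_algebra_induct)
      case (delta y)
      then show ?case
        using \<open>x \<in> carrier G\<close> \<phi>(1)
        by (simp add: G.delta_mult H.delta_mult \<open>\<And>x. _ \<Longrightarrow> p (delta R x) = _\<close> \<phi>_closed hom_mult)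
    qed (simp_all add: \<open>x \<in> carrier G\<close> G.mult_zero_F H.mult_zero_F zero add smult closed G.r_distr_F
        H.r_distr_F G.smult_mult_right_F H.smult_mult_right_F G.delta_closed G.mult_closed_F)
  qed (simp_all add: that G.mult_zero_F H.mult_zero_F zero add smult closed G.l_distr_F
        H.l_distr_F G.smult_mult_left_F H.smult_mult_left_F G.mult_closed_F)
  show "ring_hom_ring G.F H.F p"
    by (rule ring_hom_ringI[OF G.FA.A.ring_axioms H.FA.A.ring_axioms])
      (simp_all add: closed mult add delta \<phi>(2))
  show "p (delta R x) = delta R (\<phi> x)" if "x \<in> carrier G" using that by (rule delta)
  show "p (c \<odot>\<^bsub>G.F\<^esub> f) = c \<odot>\<^bsub>H.F\<^esub> p f" if "c \<in> carrier R" "f \<in> carrier G.F"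
    using that by (simp add: smult)
qed

lemma (in ring_hom_ring) quotient_hom:
  assumes "ideal I R" "ideal J S" "h ` I \<subseteq> J"
  obtains h' where "ring_hom_ring (R Quot I) (S Quot J) h'"
    and "\<And>a. a \<in> carrier R \<Longrightarrow> h' (I +>\<^bsub>R\<^esub> a) = J +>\<^bsub>S\<^esub> h a"
proof -
  interpret I: ideal I R by fact
  interpret J: ideal J S by fact
  \<comment> \<open>The image collects the target cosets of all representatives of \<open>B\<close>.
    Two representatives differ by an element of \<open>I\<close>, which \<open>h\<close> sends into
    \<open>J\<close>, so this image is a singleton.\<close>
  define h' where "h' B = the_elem ((\<lambda>a. J +>\<^bsub>S\<^esub> h a) ` B)" for B
  have h': "h' (I +>\<^bsub>R\<^esub> a) = J +>\<^bsub>S\<^esub> h a" if a: "a \<in> carrier R" for a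
  proof -
    have "J +>\<^bsub>S\<^esub> h b = J +>\<^bsub>S\<^esub> h a" if b: "b \<in> I +>\<^bsub>R\<^esub> a" for b
    proof -
      from b obtain i where i: "i \<in> I" "b = i \<oplus>\<^bsub>R\<^esub> a" by (auto simp: a_r_coset_def')
      then have "h b = h i \<oplus>\<^bsub>S\<^esub> h a"
        using abelian_group.hom_add[OF I.a_Hcarr[OF i(1)] a] by simp
      moreover have "h i \<in> J" using i(1) assms(3) by blast
      ultimately have "h b \<in> J +>\<^bsub>S\<^esub> h a" by (auto simp: a_r_coset_def')
      then show ?thesis using J.a_repr_independence'[OF _ hom_closed[OF a]] by blast
    qed
    then have "(\<lambda>a. J +>\<^bsub>S\<^esub> h a) ` (I +>\<^bsub>R\<^esub> a) = {J +>\<^bsub>S\<^esub> h a}"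
      using I.a_rcos_self[OF a] by blast
    then show ?thesis by (simp add: h'_def)
  qed
  have "ring_hom_ring (R Quot I) (S Quot J) h'"
  proof (rule ring_hom_ringI[OF I.quotient_is_ring J.quotient_is_ring])
    have coset: "\<exists>a\<in>carrier R. B = I +>\<^bsub>R\<^esub> a" if "B \<in> carrier (R Quot I)" for B
      using that by (auto simp: FactRing_def A_RCOSETS_def')
    show "h' B \<in> carrier (S Quot J)" if "B \<in> carrier (R Quot I)" for B
      using coset[OF that] by (auto simp: h' FactRing_def A_RCOSETS_def')
    show "h' (B \<otimes>\<^bsub>R Quot I\<^esub> C) = h' B \<otimes>\<^bsub>S Quot J\<^esub> h' C"
      if "B \<in> carrier (R Quot I)" "C \<in> carrier (R Quot I)" for B C
      using coset[OF that(1)] coset[OF that(2)]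
      by (auto simp: FactRing_def I.rcoset_mult_add J.rcoset_mult_add h')
    show "h' (B \<oplus>\<^bsub>R Quot I\<^esub> C) = h' B \<oplus>\<^bsub>S Quot J\<^esub> h' C"
      if "B \<in> carrier (R Quot I)" "C \<in> carrier (R Quot I)" for B C
      using coset[OF that(1)] coset[OF that(2)]
      by (auto simp: FactRing_def I.a_rcos_sum J.a_rcos_sum h')
    show "h' \<one>\<^bsub>R Quot I\<^esub> = \<one>\<^bsub>S Quot J\<^esub>"
      by (simp add: FactRing_def h')
  qed
  with h' show thesis using that by blast
qed

section \<open>Tensor powers\<close>

lemma (in ring) finsum_commute:
  assumes "finite I" "finite J" "f \<in> I \<rightarrow> carrier R" "g \<in> J \<rightarrow> carrier R"
    and comm: "\<And>i j. \<lbrakk>i \<in> I; j \<in> J\<rbrakk> \<Longrightarrow> f i \<otimes> g j = g j \<otimes> f i"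
  shows "(\<Oplus>i\<in>I. f i) \<otimes> (\<Oplus>j\<in>J. g j) = (\<Oplus>j\<in>J. g j) \<otimes> (\<Oplus>i\<in>I. f i)"
proof -
  have *: "(\<Oplus>i\<in>I. f i) \<otimes> g j = g j \<otimes> (\<Oplus>i\<in>I. f i)" if "j \<in> J" for j
    using assms that
    by (auto simp: finsum_ldistr finsum_rdistr Pi_iff intro!: finsum_cong')
  show ?thesis
    using assms *
    by (subst (1 2) finsum_ldistr finsum_rdistr) (auto simp: Pi_iff finsum_closed intro!: finsum_cong')
qed

lemma (in ring_hom_ring) hom_Units:
  assumes "x \<in> Units R"
  shows "h x \<in> Units S"
  using assms unfolding Units_def
  by clarsimp (metis hom_closed hom_mult hom_one)

context assoc_algebra
begin

lemma carrier_cartesian_power: "carrier (cartesian_power A n) = {1..n} \<rightarrow>\<^sub>E carrier A"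
  by (simp add: cartesian_power_def)

lemma mult_cartesian_power: "x \<otimes>\<^bsub>cartesian_power A n\<^esub> y = (\<lambda>l\<in>{1..n}. x l \<otimes>\<^bsub>A\<^esub> y l)"
  by (simp add: cartesian_power_def)

lemma one_cartesian_power: "\<one>\<^bsub>cartesian_power A n\<^esub> = (\<lambda>l\<in>{1..n}. \<one>\<^bsub>A\<^esub>)"
  by (simp add: cartesian_power_def)

lemma monoid_cartesian_power: "Group.monoid (cartesian_power A n)"
  by (rule monoidI)
    (auto simp: carrier_cartesian_power mult_cartesian_power one_cartesian_power PiE_iff
      extensional_def fun_eq_iff A.m_assoc)

lemma cring_monoid_cartesian_power: "cring_monoid R (cartesian_power A n)"
  by (intro cring_monoid.intro R.is_cring monoid_cartesian_power)

lemma multilinear_rels_induct [consumes 1, case_names add smult]: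
  assumes "r \<in> multilinear_rels R A n"
    and "\<And>x i a b. \<lbrakk>x \<in> carrier (cartesian_power A n); i \<in> {1..n}; a \<in> carrier A; b \<in> carrier A\<rbrakk> \<Longrightarrow>
      P (delta R (x(i := a \<oplus>\<^bsub>A\<^esub> b)) \<ominus>\<^bsub>free_tensors R A n\<^esub>
       (delta R (x(i := a)) \<oplus>\<^bsub>free_tensors R A n\<^esub> delta R (x(i := b))))"
    and "\<And>x i c a. \<lbrakk>x \<in> carrier (cartesian_power A n); i \<in> {1..n}; c \<in> carrier R; a \<in> carrier A\<rbrakk> \<Longrightarrow>
      P (delta R (x(i := c \<odot>\<^bsub>A\<^esub> a)) \<ominus>\<^bsub>free_tensors R A n\<^esub>
       (c \<odot>\<^bsub>free_tensors R A n\<^esub> delta R (x(i := a))))"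
  shows "P r"
  using assms unfolding multilinear_rels_def by blast

lemma multilinear_rels_add:
  "\<lbrakk>x \<in> carrier (cartesian_power A n); i \<in> {1..n}; a \<in> carrier A; b \<in> carrier A\<rbrakk> \<Longrightarrow>
    delta R (x(i := a \<oplus>\<^bsub>A\<^esub> b)) \<ominus>\<^bsub>free_tensors R A n\<^esub>
      (delta R (x(i := a)) \<oplus>\<^bsub>free_tensors R A n\<^esub> delta R (x(i := b))) \<in> multilinear_rels R A n"
  unfolding multilinear_rels_def by blast

lemma multilinear_rels_smult:
  "\<lbrakk>x \<in> carrier (cartesian_power A n); i \<in> {1..n}; c \<in> carrier R; a \<in> carrier A\<rbrakk> \<Longrightarrow>
    delta R (x(i := c \<odot>\<^bsub>A\<^esub> a)) \<ominus>\<^bsub>free_tensors R A n\<^esub>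
      (c \<odot>\<^bsub>free_tensors R A n\<^esub> delta R (x(i := a))) \<in> multilinear_rels R A n"
  unfolding multilinear_rels_def by blast

lemma cartesian_power_upd:
  "\<lbrakk>x \<in> carrier (cartesian_power A n); i \<in> {1..n}; a \<in> carrier A\<rbrakk> \<Longrightarrow>
    x(i := a) \<in> carrier (cartesian_power A n)"
  by (auto simp: carrier_cartesian_power PiE_iff extensional_def)

text \<open>A tuple altered in slot \<open>i\<close> stays so after multiplication by
  \<open>y\<close>; hence a relation in slot \<open>i\<close> is carried to a relation in slot
  \<open>i\<close>.\<close>

lemma mult_upd:
  assumes "i \<in> {1..n}"
  shows "y \<otimes>\<^bsub>cartesian_power A n\<^esub> x(i := a) = (y \<otimes>\<^bsub>cartesian_power A n\<^esub> x)(i := y i \<otimes>\<^bsub>A\<^esub> a)"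
    and "x(i := a) \<otimes>\<^bsub>cartesian_power A n\<^esub> y = (x \<otimes>\<^bsub>cartesian_power A n\<^esub> y)(i := a \<otimes>\<^bsub>A\<^esub> y i)"
  using assms by (auto simp: mult_cartesian_power fun_eq_iff)

lemma multilinear_rels_subset: "multilinear_rels R A n \<subseteq> carrier (free_tensors R A n)"
proof
  interpret F: cring_monoid R "cartesian_power A n" by (rule cring_monoid_cartesian_power)
  fix r assume "r \<in> multilinear_rels R A n"
  then show "r \<in> carrier (free_tensors R A n)"
    by (induction rule: multilinear_rels_induct)
      (auto simp: free_tensors_def cartesian_power_upd F.delta_closed
        intro!: F.F.M.minus_closed F.add_closed_F F.smult_closed_F)
qed

text \<open>The generating set is itself stable under multiplication by tuples: the base tuple
  \<open>x\<close> becomes a product with \<open>y\<close>, and the entries in slot \<open>i\<close>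
  are multiplied by \<open>y i\<close>. Distributivity in \<open>A\<close> handles the additive
  relations, compatibility of scalars with the product the others.\<close>

lemma ideal_multilinear_span: "ideal (multilinear_span R A n) (free_tensors R A n)"
proof -
  interpret F: cring_monoid R "cartesian_power A n" by (rule cring_monoid_cartesian_power)
  have component: "y i \<in> carrier A" if "y \<in> carrier (cartesian_power A n)" "i \<in> {1..n}" for y i
    using that by (auto simp: carrier_cartesian_power)
  have minus: "h \<otimes>\<^bsub>F.F\<^esub> (f \<ominus>\<^bsub>F.F\<^esub> g) = h \<otimes>\<^bsub>F.F\<^esub> f \<ominus>\<^bsub>F.F\<^esub> h \<otimes>\<^bsub>F.F\<^esub> g"
      "(f \<ominus>\<^bsub>F.F\<^esub> g) \<otimes>\<^bsub>F.F\<^esub> h = f \<otimes>\<^bsub>F.F\<^esub> h \<ominus>\<^bsub>F.F\<^esub> g \<otimes>\<^bsub>F.F\<^esub> h"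
    if "f \<in> carrier F.F" "g \<in> carrier F.F" "h \<in> carrier F.F" for f g h
    using that by (simp_all add: a_minus_def F.r_distr_F F.l_distr_F F.FA.A.r_minus F.FA.A.l_minus)
  note simps = free_tensors_def minus cartesian_power_upd F.delta_closed F.delta_mult mult_upd
    F.add_closed_F F.smult_closed_F F.r_distr_F F.l_distr_F F.smult_mult_left_F F.smult_mult_right_F
    component A.r_distr A.l_distr smult_mult_left smult_mult_right
  show ?thesis
    unfolding multilinear_span_def free_tensors_def
  proof (rule F.submodule_span_ideal)
    show "multilinear_rels R A n \<subseteq> carrier F.F"
      using multilinear_rels_subset by (simp add: free_tensors_def)
    fix y r assume y: "y \<in> carrier (cartesian_power A n)" and "r \<in> multilinear_rels R A n"
    from this(2) show "delta R y \<otimes>\<^bsub>F.F\<^esub> r \<in> multilinear_rels R A n"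
    proof (induction rule: multilinear_rels_induct)
      case (add x i a b)
      then show ?case
        using y multilinear_rels_add[of "y \<otimes>\<^bsub>cartesian_power A n\<^esub> x" n i "y i \<otimes>\<^bsub>A\<^esub> a" "y i \<otimes>\<^bsub>A\<^esub> b"]
        by (simp add: simps)
    next
      case (smult x i c a)
      then show ?case
        using y multilinear_rels_smult[of "y \<otimes>\<^bsub>cartesian_power A n\<^esub> x" n i c "y i \<otimes>\<^bsub>A\<^esub> a"]
        by (simp add: simps)
    qed
    from \<open>r \<in> _\<close> show "r \<otimes>\<^bsub>F.F\<^esub> delta R y \<in> multilinear_rels R A n"
    proof (induction rule: multilinear_rels_induct)
      case (add x i a b)
      then show ?case
        using y multilinear_rels_add[of "x \<otimes>\<^bsub>cartesian_power A n\<^esub> y" n i "a \<otimes>\<^bsub>A\<^esub> y i" "b \<otimes>\<^bsub>A\<^esub> y i"]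
        by (simp add: simps)
    next
      case (smult x i c a)
      then show ?case
        using y multilinear_rels_smult[of "x \<otimes>\<^bsub>cartesian_power A n\<^esub> y" n i c "a \<otimes>\<^bsub>A\<^esub> y i"]
        by (simp add: simps)
    qed
  qed
qed

lemma ring_tensor_power: "ring (tensor_power R A n)"
  unfolding tensor_power_def by (rule ideal.quotient_is_ring[OF ideal_multilinear_span])

lemma restrict_closed:
  "x \<in> {1..n} \<rightarrow> carrier A \<Longrightarrow> restrict x {1..n} \<in> carrier (cartesian_power A n)"
  by (auto simp: carrier_cartesian_power)

lemma delta_restrict_closed:
  assumes "x \<in> {1..n} \<rightarrow> carrier A"
  shows "delta R (restrict x {1..n}) \<in> carrier (free_tensors R A n)"
  using cring_monoid.delta_closed[OF cring_monoid_cartesian_power restrict_closed[OF assms]]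
  by (simp add: free_tensors_def)

lemma pure_tensor_closed:
  assumes "x \<in> {1..n} \<rightarrow> carrier A"
  shows "pure_tensor R A n x \<in> carrier (tensor_power R A n)"
  using delta_restrict_closed[OF assms]
  by (auto simp: pure_tensor_def tensor_power_def FactRing_def A_RCOSETS_def')

lemma pure_tensor_mult:
  assumes "x \<in> {1..n} \<rightarrow> carrier A" "y \<in> {1..n} \<rightarrow> carrier A"
  shows "pure_tensor R A n x \<otimes>\<^bsub>tensor_power R A n\<^esub> pure_tensor R A n y =
    pure_tensor R A n (\<lambda>l. x l \<otimes>\<^bsub>A\<^esub> y l)"
proof -
  interpret F: cring_monoid R "cartesian_power A n" by (rule cring_monoid_cartesian_power)
  interpret I: ideal "multilinear_span R A n" "free_tensors R A n" by (rule ideal_multilinear_span)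
  have "delta R (restrict x {1..n}) \<otimes>\<^bsub>free_tensors R A n\<^esub> delta R (restrict y {1..n})
      = delta R (\<lambda>l\<in>{1..n}. x l \<otimes>\<^bsub>A\<^esub> y l)"
    using assms F.delta_mult[OF restrict_closed restrict_closed]
    by (simp add: free_tensors_def mult_cartesian_power cong: restrict_cong del: One_nat_def)
  then show ?thesis
    using assms
    by (simp add: pure_tensor_def tensor_power_def FactRing_def I.rcoset_mult_add
        delta_restrict_closed del: One_nat_def)
qed

lemma pure_tensor_cong:
  "(\<And>l. l \<in> {1..n} \<Longrightarrow> x l = y l) \<Longrightarrow> pure_tensor R A n x = pure_tensor R A n y"
  by (simp add: pure_tensor_def cong: restrict_cong)

section \<open>Placing tensor factors\<close>

definition place :: "(nat \<Rightarrow> nat) \<Rightarrow> nat \<Rightarrow> (nat \<Rightarrow> 'c) \<Rightarrow> nat \<Rightarrow> 'c" where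
  "place \<tau> p x l = (if l \<in> \<tau> ` {1..p} then x (inv_into {1..p} \<tau> l) else \<one>\<^bsub>A\<^esub>)"

text \<open>Filling the free slots with \<one> makes placement of tuples multiplicative and unital.
  Its linear extension sends relations to relations, hence span to span, and so passes to the
  quotients.\<close>

lemma tensor_power_hom:
  assumes \<tau>: "inj_on \<tau> {1..p}" "\<tau> ` {1..p} \<subseteq> {1..n}"
  obtains h where "ring_hom_ring (tensor_power R A p) (tensor_power R A n) h"
    and "\<And>x. x \<in> {1..p} \<rightarrow> carrier A \<Longrightarrow> h (pure_tensor R A p x) = pure_tensor R A n (place \<tau> p x)"
proof -
  interpret P: cring_monoid R "cartesian_power A p" by (rule cring_monoid_cartesian_power)
  interpret N: cring_monoid R "cartesian_power A n" by (rule cring_monoid_cartesian_power)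
  \<comment> \<open>Elements of the Cartesian power are extensional functions, hence the
    restriction.\<close>
  define \<phi> where "\<phi> x = restrict (place \<tau> p x) {1..n}" for x
  define f where "f = pushforward R (carrier (cartesian_power A p)) \<phi>"
  have \<tau>n: "\<tau> i \<in> {1..n}" if "i \<in> {1..p}" for i using that \<tau>(2) by blast
  have place_\<tau>: "place \<tau> p x (\<tau> i) = x i" if "i \<in> {1..p}" for x i
    using that \<tau>(1) by (simp add: place_def)
  have \<phi>_\<tau>: "\<phi> x (\<tau> i) = x i" if "i \<in> {1..p}" for x i
    using that place_\<tau> \<tau>n by (simp add: \<phi>_def)
  have place_closed: "place \<tau> p x \<in> {1..n} \<rightarrow> carrier A" if "x \<in> {1..p} \<rightarrow> carrier A" for x
    using that \<tau>(1) by (auto simp: place_def Pi_iff)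
  have \<phi>_closed: "\<phi> x \<in> carrier (cartesian_power A n)" if "x \<in> carrier (cartesian_power A p)" for x
    unfolding \<phi>_def using that by (intro restrict_closed place_closed) (auto simp: carrier_cartesian_power)
  have hom: "\<phi> \<in> hom (cartesian_power A p) (cartesian_power A n)"
  proof (rule homI)
    fix x y assume "x \<in> carrier (cartesian_power A p)" "y \<in> carrier (cartesian_power A p)"
    then show "\<phi> (x \<otimes>\<^bsub>cartesian_power A p\<^esub> y) = \<phi> x \<otimes>\<^bsub>cartesian_power A n\<^esub> \<phi> y"
      using \<tau>(1) by (auto simp: \<phi>_def place_def mult_cartesian_power fun_eq_iff)
  qed (rule \<phi>_closed)
  have one: "\<phi> \<one>\<^bsub>cartesian_power A p\<^esub> = \<one>\<^bsub>cartesian_power A n\<^esub>"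
    using \<tau>(1) by (auto simp: \<phi>_def place_def one_cartesian_power fun_eq_iff)
  have inj: "inj_on \<phi> (carrier (cartesian_power A p))"
  proof (rule inj_onI)
    fix x y
    assume xy: "x \<in> carrier (cartesian_power A p)" "y \<in> carrier (cartesian_power A p)" "\<phi> x = \<phi> y"
    then have "x i = y i" if "i \<in> {1..p}" for i
      using \<phi>_\<tau>[OF that, of x] \<phi>_\<tau>[OF that, of y] by simp
    with xy show "x = y" unfolding carrier_cartesian_power by (blast intro: PiE_ext)
  qed
  note push = pushforward_ring_hom[OF R.is_cring monoid_cartesian_power monoid_cartesian_power hom one inj,
      folded f_def]
  interpret f: ring_hom_ring P.F N.F f by (rule push(1))
  have \<phi>_upd: "\<phi> (x(i := a)) = (\<phi> x)(\<tau> i := a)" if "i \<in> {1..p}" for x i a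
  proof
    fix l
    consider k where "k \<in> {1..p}" "l = \<tau> k" | "l \<notin> \<tau> ` {1..p}" by blast
    then show "\<phi> (x(i := a)) l = ((\<phi> x)(\<tau> i := a)) l"
    proof cases
      case (1 k)
      then show ?thesis
        using that inj_on_eq_iff[OF \<tau>(1) _ that, of k] by (simp add: \<phi>_\<tau> del: One_nat_def)
    next
      case 2
      then have "l \<noteq> \<tau> i" using that by blast
      with 2 show ?thesis by (simp add: \<phi>_def place_def del: One_nat_def)
    qed
  qed
  have f_minus: "f (u \<ominus>\<^bsub>P.F\<^esub> v) = f u \<ominus>\<^bsub>N.F\<^esub> f v" if "u \<in> carrier P.F" "v \<in> carrier P.F" for u v
    using that by (simp add: a_minus_def)
  note simps = free_tensors_def f_minus push \<phi>_closed cartesian_power_upd \<phi>_upd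
    P.delta_closed P.add_closed_F P.smult_closed_F
  let ?J = "multilinear_span R A n"
  interpret J: ideal ?J N.F
    using ideal_multilinear_span by (simp add: free_tensors_def)
  have J: "submodule ?J R N.F"
    using N.F.submodule_span_submodule multilinear_rels_subset
    by (simp add: multilinear_span_def free_tensors_def)
  have "submodule {u \<in> carrier P.F. f u \<in> ?J} R P.F"
    by (rule P.F.submoduleI)
      (use N.F.submoduleE(3,4,5)[OF J] J.zero_closed
        in \<open>auto simp: P.zero_closed_F P.add_closed_F P.smult_closed_F push f.hom_zero[simplified]\<close>)
  moreover have "multilinear_rels R A p \<subseteq> {u \<in> carrier P.F. f u \<in> ?J}"
  proof
    fix r assume r: "r \<in> multilinear_rels R A p"
    then have "f r \<in> multilinear_rels R A n"
    proof (induction rule: multilinear_rels_induct)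
      case (add x i a b)
      then show ?case
        using multilinear_rels_add[of "\<phi> x" n "\<tau> i" a b] \<tau>n by (simp add: simps)
    next
      case (smult x i c a)
      then show ?case
        using multilinear_rels_smult[of "\<phi> x" n "\<tau> i" c a] \<tau>n by (simp add: simps)
    qed
    then show "r \<in> {u \<in> carrier P.F. f u \<in> ?J}"
      using r multilinear_rels_subset[of p] submodule_span_superset[of _ R N.F]
      by (auto simp: free_tensors_def multilinear_span_def)
  qed
  ultimately have "f ` multilinear_span R A p \<subseteq> ?J"
    using submodule_span_least unfolding multilinear_span_def free_tensors_def by blast
  moreover have "ideal (multilinear_span R A p) P.F"
    using ideal_multilinear_span by (simp add: free_tensors_def)
  ultimately obtain h where h: "ring_hom_ring (P.F Quot multilinear_span R A p) (N.F Quot ?J) h"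
    "\<And>u. u \<in> carrier P.F \<Longrightarrow> h (multilinear_span R A p +>\<^bsub>P.F\<^esub> u) = ?J +>\<^bsub>N.F\<^esub> f u"
    using f.quotient_hom[OF _ J.ideal_axioms] by blast
  have "h (pure_tensor R A p x) = pure_tensor R A n (place \<tau> p x)" if x: "x \<in> {1..p} \<rightarrow> carrier A" for x
  proof -
    have "\<phi> (restrict x {1..p}) = restrict (place \<tau> p x) {1..n}"
      using \<tau>(1) by (auto simp: \<phi>_def place_def fun_eq_iff)
    then show ?thesis
      using h(2)[OF P.delta_closed[OF restrict_closed[OF x]]] push(2)[OF restrict_closed[OF x]]
      by (simp add: pure_tensor_def free_tensors_def)
  qed
  with h(1) show thesis
    using that[of h] by (simp add: tensor_power_def free_tensors_def)
qed

context
  fixes m :: nat and e e' :: "nat \<Rightarrow> 'c"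
  assumes e: "\<And>s. s < m \<Longrightarrow> e s \<in> carrier A" and e': "\<And>s. s < m \<Longrightarrow> e' s \<in> carrier A"
begin

abbreviation leg_tensor where
  "leg_tensor n i j s \<equiv> pure_tensor R A n (\<lambda>l. if l = i then e s else if l = j then e' s else \<one>\<^bsub>A\<^esub>)"

lemma leg_tensor_closed: "leg_tensor n i j \<in> {..<m} \<rightarrow> carrier (tensor_power R A n)"
  using e e' by (auto intro!: pure_tensor_closed)

lemma leg_closed: "leg R A m e e' n i j \<in> carrier (tensor_power R A n)"
  unfolding leg_def
  by (intro abelian_monoid.finsum_closed leg_tensor_closed ring.ring_simprules
      abelian_group.axioms(1) ring.is_abelian_group ring_tensor_power)

lemma leg_hom:
  assumes \<tau>: "inj_on \<tau> {1..p}" "\<tau> ` {1..p} \<subseteq> {1..n}"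
  obtains h where "ring_hom_ring (tensor_power R A p) (tensor_power R A n) h"
    and "\<And>i j. \<lbrakk>i \<in> {1..p}; j \<in> {1..p}\<rbrakk> \<Longrightarrow> h (leg R A m e e' p i j) = leg R A m e e' n (\<tau> i) (\<tau> j)"
proof -
  obtain h where hom: "ring_hom_ring (tensor_power R A p) (tensor_power R A n) h"
    and h: "\<And>x. x \<in> {1..p} \<rightarrow> carrier A \<Longrightarrow> h (pure_tensor R A p x) = pure_tensor R A n (place \<tau> p x)"
    using tensor_power_hom[OF \<tau>] by blast
  interpret h: ring_hom_ring "tensor_power R A p" "tensor_power R A n" h by (rule hom)
  have "h (leg R A m e e' p i j) = leg R A m e e' n (\<tau> i) (\<tau> j)"
    if ij: "i \<in> {1..p}" "j \<in> {1..p}" for i j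
  proof -
    have "h (leg_tensor p i j s) = leg_tensor n (\<tau> i) (\<tau> j) s" if s: "s < m" for s
    proof -
      have "h (leg_tensor p i j s) =
          pure_tensor R A n (place \<tau> p (\<lambda>l. if l = i then e s else if l = j then e' s else \<one>\<^bsub>A\<^esub>))"
        using s e e' by (intro h) auto
      also have "\<dots> = leg_tensor n (\<tau> i) (\<tau> j) s"
      proof (rule pure_tensor_cong)
        fix l
        consider k where "k \<in> {1..p}" "l = \<tau> k" | "l \<notin> \<tau> ` {1..p}" by blast
        then show "place \<tau> p (\<lambda>l. if l = i then e s else if l = j then e' s else \<one>\<^bsub>A\<^esub>) l =
            (if l = \<tau> i then e s else if l = \<tau> j then e' s else \<one>\<^bsub>A\<^esub>)"
        proof cases
          case (1 k)
          then show ?thesis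
            using inj_on_eq_iff[OF \<tau>(1) 1(1) ij(1)] inj_on_eq_iff[OF \<tau>(1) 1(1) ij(2)] \<tau>(1)
            by (simp add: place_def del: One_nat_def)
        next
          case 2
          then have "l \<noteq> \<tau> i" "l \<noteq> \<tau> j" using ij by blast+
          with 2 show ?thesis by (simp add: place_def del: One_nat_def)
        qed
      qed
      finally show ?thesis .
    qed
    then show ?thesis
      using leg_tensor_closed[of n "\<tau> i" "\<tau> j"]
      unfolding leg_def h.hom_finsum[OF leg_tensor_closed]
      by (intro h.S.finsum_cong') auto
  qed
  with hom show thesis using that by blast
qed

lemma tensor2_eq_leg: "tensor2 R A m e e' = leg R A m e e' 2 1 2"
proof -
  have "pure_tensor R A 2 (\<lambda>l. if l = 1 then e s else e' s) = leg_tensor 2 1 2 s" for s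
    by (rule pure_tensor_cong) auto
  then show ?thesis by (simp add: tensor2_def leg_def)
qed

lemma leg_unit:
  assumes "tensor2 R A m e e' \<in> Units (tensor_power R A 2)" "i \<in> {1..n}" "j \<in> {1..n}" "i \<noteq> j"
  shows "leg R A m e e' n i j \<in> Units (tensor_power R A n)"
proof -
  let ?\<tau> = "\<lambda>l::nat. if l = 1 then i else j"
  have "inj_on ?\<tau> {1..2}" "?\<tau> ` {1..2} \<subseteq> {1..n}" using assms by (auto simp: inj_on_def)
  from leg_hom[OF this] obtain h where h: "ring_hom_ring (tensor_power R A 2) (tensor_power R A n) h"
    "\<And>i j. \<lbrakk>i \<in> {1..2}; j \<in> {1..2}\<rbrakk> \<Longrightarrow> h (leg R A m e e' 2 i j) = leg R A m e e' n (?\<tau> i) (?\<tau> j)"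
    by blast
  show ?thesis
    using ring_hom_ring.hom_Units[OF h(1) assms(1)] h(2)[of 1 2] by (simp add: tensor2_eq_leg)
qed

lemma leg_yang_baxter:
  assumes "yang_baxter R A m e e'" "{i, j, k} \<subseteq> {1..n}" "distinct [i, j, k]"
  shows "leg R A m e e' n i j \<otimes>\<^bsub>tensor_power R A n\<^esub> leg R A m e e' n i k
      \<otimes>\<^bsub>tensor_power R A n\<^esub> leg R A m e e' n j k
    = leg R A m e e' n j k \<otimes>\<^bsub>tensor_power R A n\<^esub> leg R A m e e' n i k
      \<otimes>\<^bsub>tensor_power R A n\<^esub> leg R A m e e' n i j"
proof -
  let ?\<tau> = "\<lambda>l::nat. if l = 1 then i else if l = 2 then j else k"
  have "inj_on ?\<tau> {1..3}" "?\<tau> ` {1..3} \<subseteq> {1..n}" using assms by (auto simp: inj_on_def)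
  from leg_hom[OF this] obtain h where hom: "ring_hom_ring (tensor_power R A 3) (tensor_power R A n) h"
    and h: "\<And>i j. \<lbrakk>i \<in> {1..3}; j \<in> {1..3}\<rbrakk> \<Longrightarrow> h (leg R A m e e' 3 i j) = leg R A m e e' n (?\<tau> i) (?\<tau> j)"
    by blast
  interpret h: ring_hom_ring "tensor_power R A 3" "tensor_power R A n" h by (rule hom)
  show ?thesis
    using arg_cong[where f = h, OF assms(1)[unfolded yang_baxter_def]] h[of 1 2] h[of 1 3] h[of 2 3]
    by (simp add: leg_closed)
qed

lemma leg_commute:
  assumes "{i, j} \<inter> {k, l} = {}"
  shows "leg R A m e e' n i j \<otimes>\<^bsub>tensor_power R A n\<^esub> leg R A m e e' n k l
    = leg R A m e e' n k l \<otimes>\<^bsub>tensor_power R A n\<^esub> leg R A m e e' n i j"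
  unfolding leg_def
proof (rule ring.finsum_commute[OF ring_tensor_power _ _ leg_tensor_closed leg_tensor_closed])
  fix s t assume "s \<in> {..<m}" "t \<in> {..<m}"
  then show "leg_tensor n i j s \<otimes>\<^bsub>tensor_power R A n\<^esub> leg_tensor n k l t
      = leg_tensor n k l t \<otimes>\<^bsub>tensor_power R A n\<^esub> leg_tensor n i j s"
    using e e' assms by (auto simp: pure_tensor_mult Pi_iff intro!: pure_tensor_cong)
qed simp_all

end

end

section \<open>Presented groups\<close>

context
  fixes S :: "'g set" and rels :: "('g word \<times> 'g word) set"
begin

lemma word_equiv_words:
  assumes "word_equiv S rels u v"
  shows "u \<in> lists (S \<times> UNIV) \<and> v \<in> lists (S \<times> UNIV)"
  using assms by induction auto

lemma word_equiv_append:
  assumes "word_equiv S rels u v" "w \<in> lists (S \<times> UNIV)"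
  shows word_equiv_append_left: "word_equiv S rels (w @ u) (w @ v)"
    and word_equiv_append_right: "word_equiv S rels (u @ w) (v @ w)"
proof -
  show "word_equiv S rels (w @ u) (w @ v)"
    using assms
  proof induction
    case (cancel u v g b)
    then show ?case using word_equiv.cancel[of "w @ u" S v g rels b] by simp
  next
    case (rel u v l r)
    then show ?case using word_equiv.rel[of "w @ u" S v l r rels] by simp
  next
    case (sym u v)
    then show ?case by (simp add: word_equiv.sym)
  next
    case (trans u v w')
    from word_equiv.trans[OF trans.IH] trans.prems show ?case by blast
  qed (simp add: word_equiv.refl)
  show "word_equiv S rels (u @ w) (v @ w)"
    using assms
  proof induction
    case (cancel u v g b)
    then show ?case using word_equiv.cancel[of u S "v @ w" g rels b] by simp
  next
    case (rel u v l r)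
    then show ?case using word_equiv.rel[of u S "v @ w" l r rels] by simp
  next
    case (sym u v)
    then show ?case by (simp add: word_equiv.sym)
  next
    case (trans u v w')
    from word_equiv.trans[OF trans.IH] trans.prems show ?case by blast
  qed (simp add: word_equiv.refl)
qed

lemma word_class_eq: "word_equiv S rels u v \<Longrightarrow> word_class S rels u = word_class S rels v"
  unfolding word_class_def by (blast intro: word_equiv.trans dest: word_equiv.sym)

lemma word_class_self: "u \<in> lists (S \<times> UNIV) \<Longrightarrow> u \<in> word_class S rels u"
  by (simp add: word_class_def word_equiv.refl)

lemma carrier_presented_group:
    "carrier (presented_group S rels) = word_class S rels ` lists (S \<times> UNIV)"
  and one_presented_group: "\<one>\<^bsub>presented_group S rels\<^esub> = word_class S rels []"
  by (simp_all add: presented_group_def)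

lemma presented_group_mult:
  assumes "u \<in> lists (S \<times> UNIV)" "v \<in> lists (S \<times> UNIV)"
  shows "word_class S rels u \<otimes>\<^bsub>presented_group S rels\<^esub> word_class S rels v = word_class S rels (u @ v)"
proof -
  have *: "word_class S rels (u' @ v') = word_class S rels (u @ v)"
    if "u' \<in> word_class S rels u" "v' \<in> word_class S rels v" for u' v'
  proof -
    from that have "word_equiv S rels u u'" "word_equiv S rels v v'"
      by (auto simp: word_class_def)
    then have "word_equiv S rels (u @ v) (u' @ v)" "word_equiv S rels (u' @ v) (u' @ v')"
      using assms(2) word_equiv_words[of u u'] by (blast intro: word_equiv_append)+
    then have "word_equiv S rels (u @ v) (u' @ v')" by (rule word_equiv.trans)
    then show ?thesis by (rule word_class_eq[symmetric])
  qed
  have "word_class S rels u \<otimes>\<^bsub>presented_group S rels\<^esub> word_class S rels v =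
      (\<Union>u'\<in>word_class S rels u. \<Union>v'\<in>word_class S rels v. word_class S rels (u' @ v'))"
    by (simp add: presented_group_def)
  also have "\<dots> = word_class S rels (u @ v)"
    using word_class_self[OF assms(1)] word_class_self[OF assms(2)] * by blast
  finally show ?thesis .
qed

lemma inverse_word_equiv:
  assumes "w \<in> lists (S \<times> UNIV)"
  shows "word_equiv S rels (map (\<lambda>(g, b). (g, \<not> b)) (rev w) @ w) []"
  using assms
proof induction
  case Nil
  then show ?case by (simp add: word_equiv.refl)
next
  case (Cons a w)
  obtain g b where a: "a = (g, b)" by force
  let ?w' = "map (\<lambda>(g, b). (g, \<not> b)) (rev w)"
  have "?w' \<in> lists (S \<times> UNIV)" using Cons by (auto simp: in_lists_conv_set)
  then have "word_equiv S rels (?w' @ [(g, \<not> b), (g, \<not> \<not> b)] @ w) (?w' @ w)"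
    using Cons a by (intro word_equiv.cancel) auto
  from word_equiv.trans[OF this Cons.IH] show ?case using a by simp
qed

lemma group_presented_group: "group (presented_group S rels)"
proof (rule groupI)
  fix U assume "U \<in> carrier (presented_group S rels)"
  then obtain u where u: "u \<in> lists (S \<times> UNIV)" "U = word_class S rels u"
    by (auto simp: carrier_presented_group)
  then show "\<one>\<^bsub>presented_group S rels\<^esub> \<otimes>\<^bsub>presented_group S rels\<^esub> U = U"
    by (simp add: one_presented_group presented_group_mult)
  have "map (\<lambda>(g, b). (g, \<not> b)) (rev u) \<in> lists (S \<times> UNIV)"
    using u by (auto simp: in_lists_conv_set)
  then show "\<exists>V\<in>carrier (presented_group S rels). V \<otimes>\<^bsub>presented_group S rels\<^esub> U = \<one>\<^bsub>presented_group S rels\<^esub>"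
    using u word_class_eq[OF inverse_word_equiv]
    by (intro bexI[of _ "word_class S rels (map (\<lambda>(g, b). (g, \<not> b)) (rev u))"])
      (simp_all add: one_presented_group carrier_presented_group presented_group_mult)
qed (unfold carrier_presented_group one_presented_group,
    (rule imageI, simp | elim imageE; simp add: presented_group_mult)+)

end

lemma (in group) presented_group_hom:
  assumes f: "\<And>g. g \<in> S \<Longrightarrow> f g \<in> carrier G"
  defines "ev \<equiv> \<lambda>w. foldr (\<lambda>(g, b) y. (if b then f g else inv f g) \<otimes> y) w \<one>"
  assumes rels: "\<And>l r. (l, r) \<in> rels \<Longrightarrow> ev l = ev r"
  obtains rep where "group_hom (presented_group S rels) G rep"
    and "\<And>g. g \<in> S \<Longrightarrow> rep (word_class S rels [(g, True)]) = f g"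
proof -
  have ev_Nil: "ev [] = \<one>"
    and ev_Cons: "ev ((g, b) # w) = (if b then f g else inv f g) \<otimes> ev w" for g b w
    by (simp_all add: ev_def)
  have ev_closed: "ev w \<in> carrier G" if "w \<in> lists (S \<times> UNIV)" for w
    using that by (induction w) (auto simp: ev_Nil ev_Cons f)
  have ev_append: "ev (u @ v) = ev u \<otimes> ev v" if "u \<in> lists (S \<times> UNIV)" "v \<in> lists (S \<times> UNIV)" for u v
    using that
  proof (induction u)
    case Nil
    then show ?case by (simp add: ev_Nil ev_closed)
  next
    case (Cons a u)
    moreover obtain g b where "a = (g, b)" by force
    ultimately show ?case by (simp add: ev_Cons ev_closed f m_assoc)
  qed
  have ev_equiv: "ev u = ev v" if "word_equiv S rels u v" for u v
    using that
  proof induction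
    case (cancel u v g b)
    have "ev ([(g, b), (g, \<not> b)] @ v) = ev v"
      using cancel f ev_closed[of v]
      by (cases b) (simp_all add: ev_Cons m_assoc[symmetric])
    then show ?case using cancel by (simp add: ev_append)
  next
    case (rel u v l r)
    then show ?case by (simp add: ev_append rels)
  qed auto
  define rep where "rep U = the_elem (ev ` U)" for U
  have rep: "rep (word_class S rels u) = ev u" if "u \<in> lists (S \<times> UNIV)" for u
  proof -
    have "ev ` word_class S rels u = {ev u}"
      using word_class_self[OF that] ev_equiv by (fastforce simp: word_class_def)
    then show ?thesis by (simp add: rep_def)
  qed
  have "rep \<in> hom (presented_group S rels) G"
  proof (rule homI)
    show "rep U \<in> carrier G" if "U \<in> carrier (presented_group S rels)" for U
      using that unfolding carrier_presented_group by (elim imageE) (simp add: rep ev_closed)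
    show "rep (U \<otimes>\<^bsub>presented_group S rels\<^esub> V) = rep U \<otimes> rep V"
      if "U \<in> carrier (presented_group S rels)" "V \<in> carrier (presented_group S rels)" for U V
      using that unfolding carrier_presented_group
      by (elim imageE) (simp add: rep presented_group_mult ev_append)
  qed
  then have "group_hom (presented_group S rels) G rep"
    by (intro group_hom.intro group_hom_axioms.intro group_presented_group is_group)
  moreover have "rep (word_class S rels [(g, True)]) = f g" if "g \<in> S" for g
    using that f by (simp add: rep ev_Cons ev_Nil)
  ultimately show thesis using that by blast
qed

theorem proposition2:
  fixes R :: "('k, 'r) ring_scheme"
    and A :: "('k, 'a, 'm) module_scheme"
    and n m :: nat
    and e e' :: "nat \<Rightarrow> 'a"
    and \<rho> :: "((nat \<Rightarrow> 'a) \<Rightarrow> 'k) set"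
  assumes "n \<ge> 2"
    and "assoc_algebra R A"
    and "\<And>s. s < m \<Longrightarrow> e s \<in> carrier A"
    and "\<And>s. s < m \<Longrightarrow> e' s \<in> carrier A"
    and "\<rho> = tensor2 R A m e e'"
    and "\<rho> \<in> Units (tensor_power R A 2)"
    and "yang_baxter R A m e e'"
  shows "\<exists>rep. group_hom (VP n) (units_of (tensor_power R A n)) rep \<and>
           (\<forall>i\<in>{1..n}. \<forall>j\<in>{1..n}. i \<noteq> j \<longrightarrow> rep (mu n i j) = leg R A m e e' n i j)"
proof -
  interpret assoc_algebra R A by fact
  let ?T = "tensor_power R A n" and ?U = "units_of (tensor_power R A n)"
  let ?leg = "\<lambda>(i, j). leg R A m e e' n i j"
  interpret T: ring ?T by (rule ring_tensor_power)
  interpret U: group ?U by (rule T.units_group)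
  have unit: "leg R A m e e' n i j \<in> Units ?T" if "i \<in> {1..n}" "j \<in> {1..n}" "i \<noteq> j" for i j
    using leg_unit[of m e e'] assms that by blast
  have closed: "leg R A m e e' n i j \<in> carrier ?T" for i j
    using leg_closed[of m e e'] assms by blast
  let ?ev = "\<lambda>w. foldr (\<lambda>(g, b) y. (if b then ?leg g else inv\<^bsub>?U\<^esub> ?leg g) \<otimes>\<^bsub>?U\<^esub> y) w \<one>\<^bsub>?U\<^esub>"
  have "?leg g \<in> carrier ?U" if "g \<in> VP_gens n" for g
    using that unit by (auto simp: VP_gens_def units_of_carrier)
  moreover have "?ev l = ?ev r" if "(l, r) \<in> VP_rels n" for l r
    using that unfolding VP_rels_def
  proof (elim UnE CollectE exE conjE)
    fix i j k
    assume "(l, r) = ([((i, j), True), ((i, k), True), ((j, k), True)],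
        [((j, k), True), ((i, k), True), ((i, j), True)])"
      and "{i, j, k} \<subseteq> {1..n}" "distinct [i, j, k]"
    then show ?thesis
      using leg_yang_baxter[of m e e' i j k n] assms closed
      by (simp add: units_of_mult units_of_one T.m_assoc)
  next
    fix i j k h
    assume "(l, r) = ([((i, j), True), ((k, h), True)], [((k, h), True), ((i, j), True)])"
      and "{i, j} \<inter> {k, h} = {}"
    then show ?thesis
      using leg_commute[of m e e' i j k h n] assms closed
      by (simp add: units_of_mult units_of_one)
  qed
  ultimately obtain rep where "group_hom (presented_group (VP_gens n) (VP_rels n)) ?U rep"
    and "\<And>g. g \<in> VP_gens n \<Longrightarrow> rep (word_class (VP_gens n) (VP_rels n) [(g, True)]) = ?leg g"
    using U.presented_group_hom[of "VP_gens n" ?leg "VP_rels n"] by blast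
  then show ?thesis
    unfolding VP_def mu_def by (intro exI[of _ rep]) (auto simp: VP_gens_def)
qed

end
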